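(* Let $K\hookrightarrow K(x)$ be a simple transcendental field extension, $\mu'$ a valuation of $K(x)$ whose restriction $\mu$ to $K$ has rank $1$, with $\mu'(x)>0$, and let $\{Q_i\}_{i\in\Lambda}$ be a $1$-complete set of key polynomials for $\mu'$. For every $i\in\Lambda$, the ring $gr_{\mu'_i}(K[x])$ is euclidean for $\delta_i$, i.e. for all $g,h\in K[x]$ with $h\ne0$ there exist $Q,R\in K[x]$ such that $$in_{\mu_i'}(g)=in_{\mu_i'}(h)\,in_{\mu_i'}(Q)+in_{\mu_i'}(R)\quad\text{in } gr_{\mu'_i}(K[x]),$$ with $R=0$ or $0\le\delta_i(R)<\delta_i(h)$.
   Context: Let $G$ be the value group of $\mu'$, $G_1$ its smallest nonzero isolated subgroup. Key polynomials: the set of key polynomials for $\mu'$ is a well-ordered family $\{Q_i\}_{i\in\Lambda}$ of monic polynomials of $K[x]$, indexed by ordinals $i\ge1$, of order type at most $\omega\times\omega$. Put $\beta_i=\mu'(Q_i)$. Every $f\in K[x]$ has a unique expansion $f=\sum_jc_{j,i}Q_i^j$ with $\deg c_{j,i}<\deg Q_i$ (its $i$-standard expansion), and the $i$-truncation of $\mu'$ is the valuation $\mu'_i(f)=\min_j\{j\beta_i+\mu'(c_{j,i})\}$. The family is built recursively: $Q_1=x$; $Q_{i+1}$ is a monic polynomial of least degree among the $f$ with $\mu_i'(f)<\mu'(f)$, all nonzero terms of its $i$-standard expansion having the same value; for a limit index $\lambda$, $Q_\lambda$ is a monic polynomial of least degree among the $f$ with $\mu_i'(f)<\mu'(f)$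 for all $i<\lambda$. It is $1$-complete if $\beta_i\in G_1$ for all $i\in\Lambda$ and, for every $\beta\in G_1$, the additive group $\{f\in K[x]:\mu'(f)\ge\beta\}$ is generated by the products $a\prod_{j=1}^sQ_{i_j}^{\gamma_j}$, $a\in K$, with $\mu(a)+\sum_j\gamma_j\beta_{i_j}\ge\beta$. Effective degree: for $h=\sum_jc_{j,i}Q_i^j\ne0$, $\delta_i(h)=\max\{j: j\beta_i+\mu'(c_{j,i})=\mu'_i(h)\}$, and $\delta_i(0)=-\infty$. Graded algebra: $gr_{\mu_i'}(K[x])=\bigoplus_\alpha\mathcal P_\alpha/\mathcal P_{\alpha,+}$, with $\alpha$ ranging over $\mu'_i(K[x]\setminus\{0\})$, $\mathcal P_\alpha=\{f\in K[x]:\mu_i'(f)\ge\alpha\}$, $\mathcal P_{\alpha,+}=\{f\in K[x]:\mu_i'(f)>\alpha\}$; $in_{\mu'_i}(f)$ is the class of $f\neq 0$ in degree $\mu'_i(f)$, and $in_{\mu_i'}(0)=0$. *)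

theory Defs
  imports
    "HOL-Library.Extended"
    "HOL-Library.Set_Algebras"
    "HOL-Computational_Algebra.Polynomial_Factorial"
    "HOL-Computational_Algebra.Group_Closure"
    "HOL-Algebra.Ring"
begin

section \<open>Valuations, isolated subgroups and rank\<close>

text \<open>Values lie in the type \<open>'g extended\<close>, which has both \<open>Pinf\<close> and \<open>Minf\<close>; a valuation
  takes the value \<open>Pinf\<close> at \<open>0\<close> only, and never takes the value \<open>Minf\<close>.\<close>

definition valuation :: "('k::field \<Rightarrow> 'g::linordered_ab_group_add extended) \<Rightarrow> bool" where
  "valuation v \<longleftrightarrow>
     (\<forall>x. v x \<noteq> Minf) \<and> (\<forall>x. v x = Pinf \<longleftrightarrow> x = 0) \<and>
     (\<forall>x y. v (x * y) = v x + v y) \<and> (\<forall>x y. min (v x) (v y) \<le> v (x + y))"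

definition value_set :: "('r::zero \<Rightarrow> 'g extended) \<Rightarrow> 'g set" where
  "value_set v = {\<alpha>. \<exists>x. x \<noteq> 0 \<and> v x = Fin \<alpha>}"

definition isolated_subgroup :: "'g::linordered_ab_group_add set \<Rightarrow> 'g set \<Rightarrow> bool" where
  "isolated_subgroup G D \<longleftrightarrow>
     D \<subseteq> G \<and> 0 \<in> D \<and> (\<forall>a\<in>D. \<forall>b\<in>D. a - b \<in> D) \<and>
     (\<forall>a\<in>D. \<forall>b\<in>G. 0 \<le> b \<and> b \<le> a \<longrightarrow> b \<in> D)"

text \<open>The number of proper isolated subgroups. The value is meaningful if there are finitely
  many of them; otherwise it is \<open>0\<close>, so \<open>rank G = 1\<close> has its usual meaning in all cases.\<close>

definition rank :: "'g::linordered_ab_group_add set \<Rightarrow> nat" where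
  "rank G = card {D. isolated_subgroup G D \<and> D \<noteq> G}"

definition smallest_isolated_subgroup :: "'g::linordered_ab_group_add set \<Rightarrow> 'g set" where
  "smallest_isolated_subgroup G = (LEAST D. isolated_subgroup G D \<and> D \<noteq> {0})"

text \<open>The field \<open>K(x)\<close> is \<open>'a poly fract\<close>; the following are the restrictions of a valuation
  of \<open>K(x)\<close> to \<open>K[x]\<close> and to \<open>K\<close>.\<close>

definition on_poly :: "('a::field poly fract \<Rightarrow> 'g extended) \<Rightarrow> 'a poly \<Rightarrow> 'g extended" where
  "on_poly v f = v (to_fract f)"

definition on_const :: "('a::field poly fract \<Rightarrow> 'g extended) \<Rightarrow> 'a \<Rightarrow> 'g extended" where
  "on_const v a = v (to_fract [:a:])"


section \<open>Standard expansions and truncations\<close>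

text \<open>An expansion \<open>f = (\<Sum>j. c\<^sub>j q\<^sup>j)\<close> is encoded by the polynomial \<open>c\<close> with coefficients
  \<open>c\<^sub>j\<close> in \<open>K[x]\<close>, so that its sum is \<open>poly c q\<close>.\<close>

definition std_expansion :: "'a::field poly \<Rightarrow> 'a poly \<Rightarrow> 'a poly poly" where
  "std_expansion q f =
     (THE c. f = poly c q \<and> (\<forall>j. degree (coeff c j) < degree q))"

lemma std_expansion_ex1:
  fixes q f :: "'a::field poly"
  assumes q: "0 < degree q"
  shows "\<exists>!c. f = poly c q \<and> (\<forall>j. degree (coeff c j) < degree q)"
proof (rule ex_ex1I)
  show "\<exists>c. f = poly c q \<and> (\<forall>j. degree (coeff c j) < degree q)"
  proof (induction "degree f" arbitrary: f rule: less_induct)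
    case less
    show ?case
    proof (cases "degree f < degree q")
      case True
      then have "f = poly [:f:] q \<and> (\<forall>j. degree (coeff [:f:] j) < degree q)"
        using q by (auto simp: coeff_pCons split: nat.split)
      then show ?thesis by blast
    next
      case False
      then have "degree (f div q) < degree f"
        using q by (intro degree_div_less) auto
      from less[OF this] obtain c where
        c: "f div q = poly c q" "\<forall>j. degree (coeff c j) < degree q" by blast
      have "degree (f mod q) < degree q"
        using q degree_mod_less[of q f] by force
      then have "f = poly (pCons (f mod q) c) q \<and>
          (\<forall>j. degree (coeff (pCons (f mod q) c) j) < degree q)"
        using c by (auto simp: coeff_pCons simp flip: c(1) split: nat.split)
      then show ?thesis by blast
    qed
  qed
next
  fix c d :: "'a poly poly"
  assume "f = poly c q \<and> (\<forall>j. degree (coeff c j) < degree q)"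
    and "f = poly d q \<and> (\<forall>j. degree (coeff d j) < degree q)"
  then show "c = d"
  proof (induction c arbitrary: d f)
    case 0
    then have "poly d q = 0" "\<forall>j. degree (coeff d j) < degree q" by auto
    then show ?case
    proof (induction d)
      case (pCons a d)
      have a: "degree a < degree q" using pCons.prems(2)[rule_format, of 0] by simp
      have "a = - (q * poly d q)" using pCons.prems(1) by (simp add: eq_neg_iff_add_eq_0)
      then have "q dvd a" by simp
      then have "a = 0" using a dvd_imp_degree_le[of q a] by fastforce
      moreover have "poly d q = 0"
        using pCons.prems(1) \<open>a = 0\<close> q by auto
      moreover have "\<forall>j. degree (coeff d j) < degree q"
        using pCons.prems(2) by (metis coeff_pCons_Suc)
      ultimately show ?case using pCons by simp
    qed simp
  next
    case (pCons a c)
    obtain b d' where d: "d = pCons b d'" by (cases d)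
    have a: "degree a < degree q" and b: "degree b < degree q"
      using pCons.prems[THEN conjunct2, rule_format, of 0] by (simp_all add: d)
    have eq: "a + q * poly c q = b + q * poly d' q" using pCons.prems d by simp
    have "a = (a + q * poly c q) mod q" using a by (simp add: mod_poly_less)
    also have "\<dots> = b" using b by (simp add: eq mod_poly_less)
    finally have ab: "a = b" .
    then have "poly c q = poly d' q" using eq q by auto
    moreover have "\<forall>j. degree (coeff c j) < degree q" "\<forall>j. degree (coeff d' j) < degree q"
      using pCons.prems by (metis coeff_pCons_Suc, metis d coeff_pCons_Suc)
    ultimately have "c = d'" using pCons.IH[of "poly c q" d'] by simp
    then show ?case using ab d by simp
  qed
qed

text \<open>In the remainder of this section \<open>m\<close> is a valuation of \<open>K[x]\<close>. The following is the
  value \<open>j m(q) + m(c\<^sub>j)\<close> of the \<open>j\<close>-th term of an expansion \<open>c\<close> with respect to \<open>q\<close>.\<close>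

definition term_value ::
  "('a::field poly \<Rightarrow> 'g::linordered_ab_group_add extended) \<Rightarrow> 'a poly \<Rightarrow> 'a poly poly \<Rightarrow> nat
     \<Rightarrow> 'g extended" where
  "term_value m q c j = (\<Sum>_<j. m q) + m (coeff c j)"

definition truncation ::
  "('a::field poly \<Rightarrow> 'g::linordered_ab_group_add extended) \<Rightarrow> 'a poly \<Rightarrow> 'a poly
     \<Rightarrow> 'g extended" where
  "truncation m q f =
     (let c = std_expansion q f in Min (term_value m q c ` {..degree c}))"

definition effective_degree ::
  "('a::field poly \<Rightarrow> 'g::linordered_ab_group_add extended) \<Rightarrow> 'a poly \<Rightarrow> 'a poly
     \<Rightarrow> nat extended" where
  "effective_degree m q h =
     (if h = 0 then Minf
      else Fin (Max {j. term_value m q (std_expansion q h) j = truncation m q h}))"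


section \<open>Key polynomials\<close>

text \<open>The index set is a subset \<open>\<Lambda>\<close> of a well-ordered type; successors and limits are formed
  inside \<open>\<Lambda>\<close>, hence are those of the ordinals enumerating \<open>\<Lambda>\<close>.\<close>

definition first_index :: "'i::wellorder set \<Rightarrow> 'i \<Rightarrow> bool" where
  "first_index \<Lambda> i \<longleftrightarrow> i \<in> \<Lambda> \<and> (\<forall>j\<in>\<Lambda>. i \<le> j)"

definition next_index :: "'i::wellorder set \<Rightarrow> 'i \<Rightarrow> 'i \<Rightarrow> bool" where
  "next_index \<Lambda> i k \<longleftrightarrow> i \<in> \<Lambda> \<and> k \<in> \<Lambda> \<and> i < k \<and> (\<forall>j\<in>\<Lambda>. i < j \<longrightarrow> k \<le> j)"

definition limit_index :: "'i::wellorder set \<Rightarrow> 'i \<Rightarrow> bool" where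
  "limit_index \<Lambda> k \<longleftrightarrow> k \<in> \<Lambda> \<and> \<not> first_index \<Lambda> k \<and> \<not> (\<exists>i. next_index \<Lambda> i k)"

definition order_type_le_omega_times_omega :: "'i::wellorder set \<Rightarrow> bool" where
  "order_type_le_omega_times_omega \<Lambda> \<longleftrightarrow>
     (\<exists>\<phi> :: 'i \<Rightarrow> nat \<times> nat.
        \<forall>i\<in>\<Lambda>. \<forall>j\<in>\<Lambda>. i < j \<longrightarrow> (\<phi> i, \<phi> j) \<in> less_than <*lex*> less_than)"

text \<open>Here \<open>m\<close> is the restriction to \<open>K[x]\<close> of the valuation of \<open>K(x)\<close>.\<close>

definition key_polynomials ::
  "('a::field poly \<Rightarrow> 'g::linordered_ab_group_add extended) \<Rightarrow> 'i::wellorder set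
     \<Rightarrow> ('i \<Rightarrow> 'a poly) \<Rightarrow> bool" where
  "key_polynomials m \<Lambda> Q \<longleftrightarrow>
     \<Lambda> \<noteq> {} \<and> order_type_le_omega_times_omega \<Lambda> \<and>
     (\<forall>i\<in>\<Lambda>. lead_coeff (Q i) = 1) \<and>
     (\<forall>i. first_index \<Lambda> i \<longrightarrow> Q i = [:0, 1:]) \<and>
     (\<forall>i k. next_index \<Lambda> i k \<longrightarrow>
        is_arg_min degree (\<lambda>f. truncation m (Q i) f < m f) (Q k) \<and>
        (let c = std_expansion (Q i) (Q k)
         in \<forall>j l. coeff c j \<noteq> 0 \<and> coeff c l \<noteq> 0 \<longrightarrow>
              term_value m (Q i) c j = term_value m (Q i) c l)) \<and>
     (\<forall>k. limit_index \<Lambda> k \<longrightarrow>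
        is_arg_min degree (\<lambda>f. \<forall>i\<in>\<Lambda>. i < k \<longrightarrow> truncation m (Q i) f < m f) (Q k))"

definition one_complete ::
  "('a::field poly fract \<Rightarrow> 'g::linordered_ab_group_add extended) \<Rightarrow> 'i::wellorder set
     \<Rightarrow> ('i \<Rightarrow> 'a poly) \<Rightarrow> bool" where
  "one_complete v \<Lambda> Q \<longleftrightarrow>
     (let G\<^sub>1 = smallest_isolated_subgroup (value_set v) in
      (\<forall>i\<in>\<Lambda>. on_poly v (Q i) \<in> Fin ` G\<^sub>1) \<and>
      (\<forall>\<beta>\<in>G\<^sub>1. {f. Fin \<beta> \<le> on_poly v f} =
         group_closure {smult a (\<Prod>i\<in>I. Q i ^ \<gamma> i) | a I \<gamma>.
           finite I \<and> I \<subseteq> \<Lambda> \<and>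
           Fin \<beta> \<le> on_const v a + (\<Sum>i\<in>I. \<Sum>_<\<gamma> i. on_poly v (Q i))}))"


section \<open>The graded algebra of a valuation\<close>

definition filt_ge :: "('r \<Rightarrow> 'g::linordered_ab_group_add extended) \<Rightarrow> 'g \<Rightarrow> 'r set" where
  "filt_ge w \<alpha> = {f. Fin \<alpha> \<le> w f}"

definition filt_gt :: "('r \<Rightarrow> 'g::linordered_ab_group_add extended) \<Rightarrow> 'g \<Rightarrow> 'r set" where
  "filt_gt w \<alpha> = {f. Fin \<alpha> < w f}"

text \<open>An element of the direct sum of the quotients \<open>filt_ge w \<alpha> / filt_gt w \<alpha>\<close> is a finitely
  supported family of cosets, indexed by all of \<open>'g\<close> but supported in the set of values of \<open>w\<close>.
  Sums and products of sets of ring elements are pointwise. Hence the sum of two cosets is their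
  set sum, and the product of the classes of \<open>a\<close> and \<open>b\<close> in degrees \<open>\<alpha>\<close> and \<open>\<beta>\<close> becomes the
  coset of \<open>a * b\<close> in degree \<open>\<alpha> + \<beta>\<close> once \<open>filt_gt w (\<alpha> + \<beta>)\<close> is added to their set product.\<close>

definition gr_support ::
  "('r \<Rightarrow> 'g::linordered_ab_group_add extended) \<Rightarrow> ('g \<Rightarrow> 'r set) \<Rightarrow> 'g set" where
  "gr_support w u = {\<alpha>. u \<alpha> \<noteq> filt_gt w \<alpha>}"

definition gr ::
  "('r::comm_ring_1 \<Rightarrow> 'g::linordered_ab_group_add extended) \<Rightarrow> ('g \<Rightarrow> 'r set) ring" where
  "gr w =
    \<lparr>carrier = {u. (\<forall>\<alpha>. \<exists>f\<in>filt_ge w \<alpha>. u \<alpha> = f +o filt_gt w \<alpha>) \<and>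
                   gr_support w u \<subseteq> value_set w \<and> finite (gr_support w u)},
     monoid.mult = (\<lambda>u u' \<gamma>.
       (\<Sum>(\<alpha>, \<beta>) \<in> {(\<alpha>, \<beta>). \<alpha> \<in> gr_support w u \<and> \<beta> \<in> gr_support w u' \<and> \<alpha> + \<beta> = \<gamma>}. u \<alpha> * u' \<beta>)
       + filt_gt w \<gamma>),
     one = (\<lambda>\<alpha>. if \<alpha> = 0 then 1 +o filt_gt w 0 else filt_gt w \<alpha>),
     zero = filt_gt w,
     add = (\<lambda>u u' \<alpha>. u \<alpha> + u' \<alpha>)\<rparr>"

definition initial_form ::
  "('r::comm_ring_1 \<Rightarrow> 'g::linordered_ab_group_add extended) \<Rightarrow> 'r \<Rightarrow> 'g \<Rightarrow> 'r set" where
  "initial_form w f =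
     (if f = 0 then \<zero>\<^bsub>gr w\<^esub>
      else (\<lambda>\<alpha>. if w f = Fin \<alpha> then f +o filt_gt w \<alpha> else filt_gt w \<alpha>))"

end

theory Submission
  imports Defs
begin

text \<open>
  Write \<open>m\<close> for the valuation on \<open>K[x]\<close>, \<open>q\<close> for the key polynomial and \<open>w\<close> for the truncation
  of \<open>m\<close> at \<open>q\<close>. The graded algebra of \<open>w\<close> is euclidean because it looks like a polynomial ring
  in the initial form of \<open>q\<close> whose coefficients, the initial forms of polynomials of degree less
  than \<open>degree q\<close>, are invertible, and the effective degree is the degree in that variable.

  Everything rests on one property of \<open>q\<close>, the assumption \<open>residual\<close> of the locale
  \<open>residual_truncation\<close>: if \<open>a\<close> and \<open>b\<close> are nonzero of degree less than \<open>degree q\<close>, and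
  \<open>a b = s q + r\<close> is the division by \<open>q\<close>, then \<open>m(s q) > m(a b)\<close>, so that \<open>r\<close> has the same
  initial form as \<open>a b\<close>. In other words the coefficients of the graded algebra multiply without a
  carry. It has three consequences:

  \<^item> \<open>w\<close> is multiplicative (\<open>truncation_mult\<close>), by comparing lowest terms as in Gauss's lemma;
  hence initial forms multiply (\<open>initial_form_mult\<close>).

  \<^item> \<open>q\<close> is irreducible, since a proper factorization \<open>a b = q\<close> would have \<open>s = 1\<close> and
  contradict \<open>m(s q) > m(a b)\<close>. So a nonzero \<open>c\<close> of degree less than \<open>degree q\<close> is invertible
  modulo \<open>q\<close>, and by the residue property the inverse modulo \<open>q\<close> inverts its initial form
  (\<open>approximate_quotient\<close>).

  \<^item> Division with remainder works (\<open>initial_division\<close>): modulo terms of larger value, \<open>h\<close> is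
  \<open>c q\<^sup>d\<close> plus an expansion of length \<open>d\<close>, where \<open>d\<close> is its effective degree, and \<open>c\<close> can be
  used to cancel leading terms of a dividend.

  The residue property is proved by transfinite induction on the index of the key polynomial,
  together with the monotonicity of the truncations (\<open>key_polynomials_residual\<close>). For \<open>q = x\<close>,
  products of constants leave no carry. For a later key polynomial, the minimality
  of \<open>degree q\<close> means that finitely many given polynomials of smaller degree keep their value
  under the truncation at some earlier key polynomial, whereas \<open>q\<close> itself gets a smaller value.
  That truncation is already known to be a valuation, and if \<open>m(s q)\<close> were at most \<open>m(a b)\<close>,
  computing the value of \<open>r\<close> in both valuations would give a contradiction
  (\<open>residual_of_approximations\<close>).
\<close>

section \<open>Valuations on the polynomial ring\<close>

lemma extended_add_strict_left_mono:
  fixes x y z :: "'g::linordered_ab_group_add extended"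
  assumes "x < y" "z \<noteq> \<infinity>" "z \<noteq> -\<infinity>"
  shows "z + x < z + y"
  using assms by (cases x; cases y; cases z) auto

locale poly_valuation =
  fixes m :: "'a::field poly \<Rightarrow> 'g::linordered_ab_group_add extended"
  assumes not_Minf [simp]: "m f \<noteq> -\<infinity>"
    and eq_Pinf_iff [simp]: "m f = \<infinity> \<longleftrightarrow> f = 0"
    and mult: "m (f * g) = m f + m g"
    and add: "min (m f) (m g) \<le> m (f + g)"
begin

lemma zero [simp]: "m 0 = \<infinity>"
  by simp

lemma finite_value:
  assumes "f \<noteq> 0"
  obtains \<alpha> where "m f = Fin \<alpha>"
  using assms by (cases "m f") auto

lemma one: "m 1 = 0"
proof -
  obtain a where a: "m 1 = Fin a" using finite_value[of 1] by auto
  have "m 1 = m 1 + m 1" using mult[of 1 1] by simp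
  then show ?thesis using a by (simp add: zero_extended_def)
qed

lemma minus [simp]: "m (- f) = m f"
proof -
  obtain a where a: "m (- 1) = Fin a" using finite_value[of "- 1"] by auto
  have "m (- 1) + m (- 1) = 0" using mult[of "- 1" "- 1"] one by simp
  then have "a = 0" using a by (simp add: zero_extended_def)
  then show ?thesis using mult[of "- 1" f] a by (simp flip: zero_extended_def)
qed

lemma diff_commute: "m (f - g) = m (g - f)"
  using minus[of "f - g"] by simp

lemma add_ge: "x \<le> m f \<Longrightarrow> x \<le> m g \<Longrightarrow> x \<le> m (f + g)"
  using add[of f g] by (meson min.boundedI order_trans)

lemma add_gt: "x < m f \<Longrightarrow> x < m g \<Longrightarrow> x < m (f + g)"
  using add[of f g] by (meson min_less_iff_conj order_less_le_trans)

lemma diff_ge: "x \<le> m f \<Longrightarrow> x \<le> m g \<Longrightarrow> x \<le> m (f - g)"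
  using add_ge[of x f "- g"] by simp

lemma diff_gt: "x < m f \<Longrightarrow> x < m g \<Longrightarrow> x < m (f - g)"
  using add_gt[of x f "- g"] by simp

lemma remainder_ge:
  assumes "x \<le> m f" "x \<le> m g" "x < m (f - g - r)"
  shows "x \<le> m r"
proof -
  have "x \<le> m ((f - g) - (f - g - r))" by (intro diff_ge assms(1,2) less_imp_le[OF assms(3)])
  moreover have "(f - g) - (f - g - r) = r" by simp
  ultimately show ?thesis by (simp only:)
qed

lemma sum_gt:
  assumes "finite S" "\<And>j. j \<in> S \<Longrightarrow> Fin \<alpha> < m (f j)"
  shows "Fin \<alpha> < m (sum f S)"
  using assms by (induction S rule: finite_induct) (auto intro: add_gt)

lemma add_eq_min:
  assumes "m f \<noteq> m g"
  shows "m (f + g) = min (m f) (m g)"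
proof -
  have *: "m (f + g) = m f" if "m f < m g" for f g
  proof (rule antisym)
    show "m f \<le> m (f + g)" using that by (intro add_ge) auto
    show "m (f + g) \<le> m f"
    proof (rule ccontr)
      assume "\<not> m (f + g) \<le> m f"
      then have "m f < m (f + g - g)" using that by (intro diff_gt) auto
      then show False by simp
    qed
  qed
  show ?thesis
  proof (cases "m f < m g")
    case True then show ?thesis using *[of f g] by simp
  next
    case False
    then have "m g < m f" using assms by simp
    then show ?thesis using *[of g f] by (simp add: add.commute)
  qed
qed

lemma value_power: "m (q ^ d) = (\<Sum>_<d. m q)"
  by (induction d) (simp_all add: one mult add.commute)

end

section \<open>The truncation as a function of quotient and remainder\<close>

locale truncated_valuation = poly_valuation m
  for m :: "'a::field poly \<Rightarrow> 'g::linordered_ab_group_add extended" +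
  fixes q :: "'a poly"
  assumes degree_pos: "0 < degree q"
begin

abbreviation w where "w \<equiv> truncation m q"

lemma q_nonzero [simp]: "q \<noteq> 0"
  using degree_pos by auto

lemma std_expansion:
  shows "poly (std_expansion q f) q = f"
    and "degree (coeff (std_expansion q f) j) < degree q"
  using theI'[OF std_expansion_ex1[OF degree_pos, of f]] unfolding std_expansion_def by auto

lemma std_expansion_eqI:
  assumes "f = poly c q" "\<And>j. degree (coeff c j) < degree q"
  shows "std_expansion q f = c"
  unfolding std_expansion_def
  by (rule the1_equality[OF std_expansion_ex1[OF degree_pos]]) (use assms in auto)

lemma std_expansion_rec:
  assumes "degree r < degree q"
  shows "std_expansion q (s * q + r) = pCons r (std_expansion q s)"
  by (rule std_expansion_eqI)
     (use assms std_expansion[of s] in \<open>auto simp: coeff_pCons split: nat.split\<close>)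

lemma std_expansion_0 [simp]: "std_expansion q 0 = 0"
  by (rule std_expansion_eqI) (use degree_pos in auto)

lemma divide_by_q:
  obtains s r where "f = s * q + r" "degree r < degree q"
proof
  show "f = f div q * q + f mod q" by simp
  show "degree (f mod q) < degree q"
    using degree_mod_less[of q f] degree_pos by auto
qed

text \<open>Induction along the standard expansion: \<open>s\<close> carries the terms of positive index and \<open>r\<close> the
  constant term, so facts about truncations need no sums over coefficients.\<close>

lemma division_induct [case_names zero step]:
  assumes "P 0" "\<And>s r. P s \<Longrightarrow> degree r < degree q \<Longrightarrow> P (s * q + r)"
  shows "P f"
proof (induction "degree f" arbitrary: f rule: less_induct)
  case less
  show ?case
  proof (cases "degree f < degree q")
    case True
    then show ?thesis using assms(2)[of 0 f] assms(1) by simp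
  next
    case False
    then have "degree (f div q) < degree f"
      using degree_pos by (intro degree_div_less) auto
    moreover have "degree (f mod q) < degree q"
      using degree_mod_less[of q f] degree_pos by auto
    ultimately show ?thesis using assms(2)[of "f div q" "f mod q"] less by simp
  qed
qed

lemma term_value_pCons [simp]:
  "term_value m q (pCons r c) 0 = m r"
  "term_value m q (pCons r c) (Suc j) = term_value m q c j + m q"
  by (simp_all add: term_value_def ac_simps)

text \<open>With this recursion, truncations can be handled by induction; the minimum over all terms is
  needed again only to read off the effective degree.\<close>

lemma truncation_rec:
  assumes "degree r < degree q"
  shows "w (s * q + r) = min (w s + m q) (m r)"
proof -
  define c where "c = std_expansion q s"
  have *: "w (s * q + r) = Min (term_value m q (pCons r c) ` {..degree (pCons r c)})"
    by (simp add: truncation_def std_expansion_rec[OF assms] c_def Let_def)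
  have ws: "w s = Min (term_value m q c ` {..degree c})"
    by (simp add: truncation_def c_def Let_def)
  show ?thesis
  proof (cases "c = 0")
    case True
    have "w s + m q = \<infinity>"
      using True by (cases "m q") (auto simp: ws term_value_def)
    then show ?thesis using True by (simp add: *)
  next
    case False
    have "{..degree (pCons r c)} = insert 0 (Suc ` {..degree c})"
      using False by (simp add: atMost_Suc_eq_insert_0)
    then have "w (s * q + r) = min (m r) (Min ((\<lambda>x. x + m q) ` (term_value m q c ` {..degree c})))"
      by (simp add: * image_image)
    also have "Min ((\<lambda>x. x + m q) ` (term_value m q c ` {..degree c})) = w s + m q"
      unfolding ws by (rule mono_Min_commute[symmetric]) (auto intro!: monoI add_right_mono)
    finally show ?thesis by (simp add: min.commute)
  qed
qed

lemma truncation_0 [simp]: "w 0 = \<infinity>"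
  by (simp add: truncation_def term_value_def)

lemma truncation_low_degree:
  assumes "degree r < degree q"
  shows "w r = m r"
  using truncation_rec[OF assms, of 0] by (cases "m q") auto

lemma truncation_q_mult: "w (s * q) = w s + m q"
  using truncation_rec[of 0 s] degree_pos by simp

lemma truncation_le: "w f \<le> m f"
proof (induction f rule: division_induct)
  case (step s r)
  have "min (w s + m q) (m r) \<le> min (m (s * q)) (m r)"
    using step add_right_mono[of "w s" "m s" "m q"] by (auto simp: mult min.coboundedI1)
  also have "\<dots> \<le> m (s * q + r)" by (rule add)
  finally show ?case by (simp add: truncation_rec step)
qed auto

lemma truncation_add: "min (w f) (w g) \<le> w (f + g)"
proof (induction f arbitrary: g rule: division_induct)
  case (step s r)
  obtain t u where g: "g = t * q + u" "degree u < degree q" by (rule divide_by_q)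
  have *: "s * q + r + g = (s + t) * q + (r + u)" by (simp add: g algebra_simps)
  let ?M = "min (w (s * q + r)) (w g)"
  have "w (s * q + r) \<le> w s + m q" "w (s * q + r) \<le> m r" "w g \<le> w t + m q" "w g \<le> m u"
    unfolding g(1) truncation_rec[OF step(2)] truncation_rec[OF g(2)] by simp_all
  then have M: "?M \<le> w s + m q" "?M \<le> w t + m q" "?M \<le> m r" "?M \<le> m u"
    by (meson min.coboundedI1 min.coboundedI2)+
  have "?M \<le> min (w s) (w t) + m q"
    using M(1,2) unfolding min_def[of "w s"] by (simp split: if_split)
  also have "\<dots> \<le> w (s + t) + m q" by (intro add_right_mono step)
  finally have 1: "min (w (s * q + r)) (w g) \<le> w (s + t) + m q" .
  have "?M \<le> min (m r) (m u)" using M(3,4) by (rule min.boundedI)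
  also have "\<dots> \<le> m (r + u)" by (rule add)
  finally have 2: "min (w (s * q + r)) (w g) \<le> m (r + u)" .
  show ?case unfolding * using 1 2 step g
    by (subst truncation_rec) (auto intro: degree_add_less)
qed auto

lemma truncation_add_ge: "x \<le> w f \<Longrightarrow> x \<le> w g \<Longrightarrow> x \<le> w (f + g)"
  using truncation_add[of f g] by (meson min.boundedI order_trans)

lemma truncation_add_gt: "x < w f \<Longrightarrow> x < w g \<Longrightarrow> x < w (f + g)"
  using truncation_add[of f g] by (meson min_less_iff_conj order_less_le_trans)

lemma truncation_not_Minf [simp]: "w f \<noteq> -\<infinity>"
proof (induction f rule: division_induct)
  case (step s r)
  have "w s + m q \<noteq> -\<infinity>"
    using step by (cases "w s"; cases "m q") (auto dest: arg_cong[where f = uminus])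
  then show ?case by (simp add: truncation_rec step min_def)
qed auto

lemma truncation_eq_Pinf_iff [simp]: "w f = \<infinity> \<longleftrightarrow> f = 0"
  using truncation_le[of f] by (cases "f = 0") auto

end

section \<open>The residue property\<close>

context truncated_valuation
begin

lemma degree_product_div:
  assumes "degree a < degree q" "degree b < degree q"
  shows "degree (a * b div q) < degree q"
proof (cases "degree (a * b) < degree q")
  case True
  then show ?thesis using degree_pos by (simp add: div_poly_less)
next
  case False
  then have ab: "a * b \<noteq> 0" using degree_pos by auto
  then have "a * b div q \<noteq> 0" using False by (auto simp: div_poly_eq_0_iff)
  moreover have "degree (a * b div q * q) \<le> degree (a * b)"
  proof -
    have "degree (a * b mod q) \<le> degree (a * b)"
      using False degree_mod_less[of q "a * b"] degree_pos by fastforce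
    moreover have "a * b div q * q = a * b - a * b mod q" by (simp add: minus_mod_eq_div_mult)
    ultimately show ?thesis by (simp add: degree_diff_le)
  qed
  ultimately have "degree (a * b div q) + degree q \<le> degree a + degree b"
    using ab by (auto simp: degree_mult_eq)
  then show ?thesis using assms by simp
qed

text \<open>The valuation \<open>u\<close> agrees with \<open>m\<close> on \<open>a\<close>, \<open>b\<close>, \<open>s\<close>, \<open>r\<close>, where \<open>a b = s q + r\<close>, but
  undervalues \<open>q\<close>. If \<open>m(s q) \<le> m(a b)\<close>, then \<open>u(s q) < u(a b)\<close>, which forces
  \<open>m(r) = u(r) = u(s q) < m(s q)\<close>, while \<open>r = a b - s q\<close> gives \<open>m(r) \<ge> m(s q)\<close>.\<close>

lemma residual_of_approximations:
  assumes approx: "\<And>S. finite S \<Longrightarrow> (\<And>f. f \<in> S \<Longrightarrow> degree f < degree q) \<Longrightarrow>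
    \<exists>u. poly_valuation u \<and> u q < m q \<and> (\<forall>f\<in>S. u f = m f)"
    and ab: "a \<noteq> 0" "b \<noteq> 0" "degree a < degree q" "degree b < degree q"
  shows "m (a * b) < m (a * b div q * q)"
proof (rule ccontr)
  define s r where "s = a * b div q" and "r = a * b mod q"
  have abq: "a * b = s * q + r" by (simp add: s_def r_def)
  assume "\<not> m (a * b) < m (a * b div q * q)"
  then have le: "m (s * q) \<le> m (a * b)" by (simp add: s_def)
  have "degree s < degree q" "degree r < degree q"
    using degree_product_div[OF ab(3,4)] degree_mod_less[of q "a * b"] degree_pos
    by (auto simp: s_def r_def)
  then have "\<exists>u. poly_valuation u \<and> u q < m q \<and> (\<forall>f\<in>{a, b, s, r}. u f = m f)"
    using ab by (intro approx) auto
  then obtain u where u: "poly_valuation u" "u q < m q"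
    and eq: "u a = m a" "u b = m b" "u s = m s" "u r = m r" by auto
  interpret u: poly_valuation u by (rule u)
  have "s \<noteq> 0" using le ab by auto
  then have "u (s * q) < m (s * q)"
    unfolding mult u.mult eq(3) using u by (intro extended_add_strict_left_mono) auto
  moreover have "u (a * b) = m (a * b)" by (simp add: mult u.mult eq)
  ultimately have "u (s * q) < u (a * b)" using le by simp
  then have "u r = u (s * q)"
    using u.add_eq_min[of "a * b" "- (s * q)"] by (simp add: abq)
  then have "m r < m (s * q)" using eq \<open>u (s * q) < m (s * q)\<close> by simp
  moreover have "m (s * q) \<le> m (a * b - s * q)" using le by (intro diff_ge) auto
  ultimately show False by (simp add: abq)
qed

text \<open>There is no cancellation under \<open>u\<close> between \<open>s q\<close> and \<open>r\<close>. It could only occur if both had the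
  same value \<open>u(r) = m(r)\<close>; then \<open>m\<close> would be larger than \<open>m(r)\<close> on \<open>s q\<close>, because it is larger
  on \<open>q\<close>, and on the sum, hence on \<open>r\<close>.\<close>

lemma approximation_le_terms:
  assumes u: "poly_valuation u" "\<And>f. u f \<le> m f" "u q < m q" "u r = m r"
  shows "u (s * q + r) \<le> u s + u q" "u (s * q + r) \<le> m r"
proof -
  interpret u: poly_valuation u by (rule u)
  have "u (s * q + r) = min (u (s * q)) (u r)"
  proof (cases "u (s * q) = u r \<and> s \<noteq> 0")
    case True
    have "u (s * q) < m (s * q)"
    proof -
      have "u s + u q < u s + m q"
        using True u by (intro extended_add_strict_left_mono) auto
      also have "\<dots> \<le> m s + m q" by (intro add_right_mono u)
      finally show ?thesis by (simp add: mult u.mult)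
    qed
    have "\<not> m r < m (s * q + r)"
    proof
      assume "m r < m (s * q + r)"
      then have "m r < m (s * q + r - s * q)"
        using \<open>u (s * q) < m (s * q)\<close> True u(4) by (intro diff_gt) auto
      then show False by simp
    qed
    then have "u (s * q + r) \<le> m r" using u(2)[of "s * q + r"] by simp
    moreover have "u r \<le> u (s * q + r)" using True by (intro u.add_ge) auto
    ultimately show ?thesis using True u(4) by simp
  next
    case False
    then show ?thesis
    proof (cases "s = 0")
      case False
      with \<open>\<not> (u (s * q) = u r \<and> s \<noteq> 0)\<close> show ?thesis by (intro u.add_eq_min) auto
    qed simp
  qed
  then show "u (s * q + r) \<le> u s + u q" "u (s * q + r) \<le> m r"
    by (simp_all add: u.mult u(4))
qed

end

section \<open>Multiplicativity of the truncation\<close>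

locale residual_truncation = truncated_valuation +
  assumes residual: "a \<noteq> 0 \<Longrightarrow> b \<noteq> 0 \<Longrightarrow> degree a < degree q \<Longrightarrow> degree b < degree q \<Longrightarrow>
    m (a * b) < m (a * b div q * q)"
begin

lemma product_residue:
  assumes "degree a < degree q" "degree b < degree q"
  obtains s r where "a * b = s * q + r" "degree s < degree q" "degree r < degree q"
    "m r = m (a * b)" "a * b \<noteq> 0 \<Longrightarrow> m (a * b) < w (s * q)"
proof
  let ?s = "a * b div q" and ?r = "a * b mod q"
  show "a * b = ?s * q + ?r" by simp
  show s: "degree ?s < degree q" by (rule degree_product_div[OF assms])
  show "degree ?r < degree q" using degree_mod_less[of q "a * b"] degree_pos by auto
  show gt: "m (a * b) < w (?s * q)" if "a * b \<noteq> 0"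
    using residual[of a b] that assms by (simp add: truncation_q_mult truncation_low_degree[OF s] mult)
  show "m ?r = m (a * b)"
  proof (cases "a * b = 0")
    case False
    then have "m (a * b) < m (?s * q)"
      using gt truncation_le[of "?s * q"] by (auto intro: order_less_le_trans)
    then have "m (a * b - ?s * q) = m (a * b)"
      using add_eq_min[of "a * b" "- (?s * q)"] by (simp add: min_def)
    then show ?thesis by (simp add: minus_div_mult_eq_mod)
  next
    case True
    then show ?thesis by auto
  qed
qed

lemma truncation_low_degree_mult_ge:
  assumes a: "degree a < degree q"
  shows "m a + w g \<le> w (a * g)"
proof (induction g rule: division_induct)
  case zero
  show ?case by simp
next
  case (step t u)
  have "m a + w (t * q + u) \<le> (m a + w t) + m q"
    by (simp add: truncation_rec step add.assoc add_left_mono)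
  also have "\<dots> \<le> w (a * t * q)" by (simp add: truncation_q_mult step add_right_mono)
  finally have 1: "m a + w (t * q + u) \<le> w (a * t * q)" .
  obtain s r where sr: "a * u = s * q + r" "degree s < degree q" "degree r < degree q"
    "m r = m (a * u)" "a * u \<noteq> 0 \<Longrightarrow> m (a * u) < w (s * q)"
    using product_residue[OF a step(2)] by metis
  have "m a + w (t * q + u) \<le> m (a * u)"
    by (simp add: truncation_rec step add_left_mono mult)
  also have "m (a * u) \<le> w (a * u)"
    using sr by (cases "a * u = 0") (auto simp: truncation_rec truncation_q_mult)
  finally have 2: "m a + w (t * q + u) \<le> w (a * u)" .
  have "a * (t * q + u) = a * t * q + a * u" by (simp add: algebra_simps)
  then show ?case using truncation_add_ge[OF 1 2] by simp
qed

lemma truncation_mult_ge: "w f + w g \<le> w (f * g)"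
proof (induction f rule: division_induct)
  case zero
  show ?case by (cases "w g") auto
next
  case (step s r)
  have "w (s * q + r) + w g \<le> (w s + m q) + w g"
    by (intro add_right_mono) (simp add: truncation_rec step)
  also have "\<dots> = (w s + w g) + m q" by (simp add: ac_simps)
  also have "\<dots> \<le> w (s * g * q)" by (simp add: truncation_q_mult step add_right_mono)
  finally have 1: "w (s * q + r) + w g \<le> w (s * g * q)" .
  have "w (s * q + r) + w g \<le> m r + w g" by (simp add: truncation_rec step add_right_mono)
  also have "\<dots> \<le> w (r * g)" by (rule truncation_low_degree_mult_ge[OF step(2)])
  finally have "w (s * q + r) + w g \<le> w (r * g)" .
  moreover have "(s * q + r) * g = s * g * q + r * g" by (simp add: algebra_simps)
  ultimately show ?case using 1 truncation_add_ge by simp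
qed

lemma truncation_uminus_ge: "w f \<le> w (- f)"
  using truncation_mult_ge[of "- 1" f] one by (simp add: truncation_low_degree degree_pos)

lemma truncation_q_power_mult: "w (q ^ d * f) = m (q ^ d) + w f"
proof (induction d)
  case (Suc d)
  have "q ^ Suc d * f = (q ^ d * f) * q" by simp
  then show ?case using Suc by (simp only: truncation_q_mult) (simp add: mult ac_simps)
qed (simp add: one)

text \<open>Here \<open>d\<close> is the smallest index at which the minimum defining \<open>w f\<close> is attained, and \<open>A\<close>
  collects the terms below it.\<close>

lemma lowest_initial_term:
  assumes "f \<noteq> 0"
  obtains A d c B where "f = A + q ^ d * (c + B * q)" "c \<noteq> 0" "degree c < degree q"
    "m (q ^ d) + m c = w f" "w f < w A"
proof -
  have "f \<noteq> 0 \<longrightarrow> (\<exists>A d c B. f = A + q ^ d * (c + B * q) \<and> c \<noteq> 0 \<and> degree c < degree q \<and>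
    m (q ^ d) + m c = w f \<and> w f < w A)"
  proof (induction f rule: division_induct)
    case (step s r)
    show ?case
    proof (intro impI)
      assume nz: "s * q + r \<noteq> 0"
      show "\<exists>A d c B. s * q + r = A + q ^ d * (c + B * q) \<and> c \<noteq> 0 \<and> degree c < degree q \<and>
        m (q ^ d) + m c = w (s * q + r) \<and> w (s * q + r) < w A"
      proof (cases "m r = w (s * q + r)")
        case True
        moreover have "w (s * q + r) < \<infinity>" using nz by (cases "w (s * q + r)") auto
        ultimately show ?thesis using step nz
          by (intro exI[of _ 0] exI[of _ r] exI[of _ s]) (auto simp: one)
      next
        case False
        then have lt: "w (s * q + r) < m r" and ws: "w (s * q + r) = w s + m q"
          by (auto simp: truncation_rec step min_def split: if_splits)
        have "s \<noteq> 0" using ws nz by (cases "m q") auto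
        then obtain A d c B where s: "s = A + q ^ d * (c + B * q)" "c \<noteq> 0" "degree c < degree q"
          "m (q ^ d) + m c = w s" "w s < w A" using step by blast
        show ?thesis
        proof (intro exI conjI)
          show "s * q + r = (A * q + r) + q ^ Suc d * (c + B * q)"
            by (subst s(1)) (simp add: algebra_simps)
          show "m (q ^ Suc d) + m c = w (s * q + r)"
            by (simp add: ws mult flip: s(4)) (simp add: ac_simps)
          have "m q + w s < m q + w A" using s by (intro extended_add_strict_left_mono) auto
          then have "w (s * q + r) < w A + m q" unfolding ws by (simp only: add.commute)
          then show "w (s * q + r) < w (A * q + r)"
            using lt by (simp only: truncation_rec[OF step(2), of A]) simp
        qed (use s in auto)
      qed
    qed
  qed simp
  then show ?thesis using assms that by blast
qed

text \<open>Gauss's argument at the lowest term. Up to summands of value larger than \<open>w f + w g\<close>, the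
  product is \<open>F G\<close> with \<open>F = q\<^sup>d (c + B q)\<close> and \<open>G = q\<^sup>e (c' + B' q)\<close>. Taking the lowest rather than
  the highest terms puts everything except the remainder of \<open>c c'\<close> modulo \<open>q\<close> into higher
  powers of \<open>q\<close>, so this remainder, whose value is \<open>m(c c')\<close>, bounds \<open>w (F G)\<close> from above.\<close>

lemma truncation_mult: "w (f * g) = w f + w g"
proof (cases "f = 0 \<or> g = 0")
  case True
  then show ?thesis by (cases "w f"; cases "w g") auto
next
  case False
  obtain A d c B where f: "f = A + q ^ d * (c + B * q)" "c \<noteq> 0" "degree c < degree q"
    "m (q ^ d) + m c = w f" "w f < w A" using lowest_initial_term False by metis
  obtain A' e c' B' where g: "g = A' + q ^ e * (c' + B' * q)" "c' \<noteq> 0" "degree c' < degree q"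
    "m (q ^ e) + m c' = w g" "w g < w A'" using lowest_initial_term False by metis
  define F G where "F = q ^ d * (c + B * q)" and "G = q ^ e * (c' + B' * q)"
  have fg: "f = A + F" "g = A' + G" using f g by (simp_all add: F_def G_def)
  have wf: "w f \<noteq> \<infinity>" "w g \<noteq> \<infinity>" using False by auto
  have 1: "w f + w g < w (A * g)"
  proof -
    have "w g + w f < w g + w A" using f wf by (intro extended_add_strict_left_mono) auto
    then show ?thesis using truncation_mult_ge[of A g] by (simp add: add.commute)
  qed
  have "w f \<le> w F"
  proof -
    have "w f \<le> w (- A)" using f(5) truncation_uminus_ge[of A] by simp
    then have "w f \<le> w (f + - A)" by (intro truncation_add_ge) simp
    then show ?thesis by (simp add: fg)
  qed
  have 2: "w f + w g < w (F * A')"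
  proof -
    have "w f + w g < w f + w A'" using g wf by (intro extended_add_strict_left_mono) auto
    also have "\<dots> \<le> w F + w A'" by (rule add_right_mono) fact
    also have "\<dots> \<le> w (F * A')" by (rule truncation_mult_ge)
    finally show ?thesis .
  qed
  obtain s r where sr: "c * c' = s * q + r" "degree s < degree q" "degree r < degree q"
    "m r = m (c * c')" using product_residue[OF f(3) g(3)] by metis
  have "F * G = q ^ (d + e) * ((s + c * B' + c' * B + B * B' * q) * q + r)"
  proof -
    have "F * G = q ^ (d + e) * (c * c' + (c * B' + c' * B + B * B' * q) * q)"
      by (simp add: F_def G_def power_add algebra_simps)
    then show ?thesis unfolding sr(1) by (simp add: algebra_simps)
  qed
  then have "w (F * G) \<le> m (q ^ (d + e)) + m r"
    by (simp only: truncation_q_power_mult truncation_rec[OF sr(3)]) (simp add: add_left_mono)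
  also have "\<dots> = w f + w g"
    by (simp add: sr(4) mult power_add ac_simps flip: f(4) g(4))
  finally have 3: "w (F * G) \<le> w f + w g" .
  have "\<not> w f + w g < w (f * g)"
  proof
    assume "w f + w g < w (f * g)"
    have "F * G = f * g + (- (A * g) + - (F * A'))" by (simp add: fg algebra_simps)
    moreover have "w f + w g < w (- (A * g))" "w f + w g < w (- (F * A'))"
      by (rule order_less_le_trans[OF 1 truncation_uminus_ge], rule order_less_le_trans[OF 2 truncation_uminus_ge])
    ultimately have "w f + w g < w (F * G)"
      using \<open>w f + w g < w (f * g)\<close> by (simp only: truncation_add_gt)
    then show False using 3 by simp
  qed
  then show ?thesis using truncation_mult_ge[of f g] by auto
qed

sublocale trunc: poly_valuation w
  by unfold_locales (simp_all add: truncation_mult truncation_add)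

end

section \<open>Every key polynomial has the residue property\<close>

text \<open>The inductive step for successor and limit indices at once: \<open>J\<close> consists of the earlier
  indices. Monotonicity in the index makes the equality of the truncation and \<open>m\<close> at a polynomial
  persist, so that a single index serves finitely many polynomials of low degree. The second
  conclusion carries monotonicity to the next index.\<close>

lemma key_polynomial_step:
  fixes m :: "'a::field poly \<Rightarrow> 'g::linordered_ab_group_add extended"
    and J :: "'i::linorder set" and P :: "'i \<Rightarrow> 'a poly"
  assumes m: "poly_valuation m" and J: "J \<noteq> {}"
    and residual: "\<And>j. j \<in> J \<Longrightarrow> residual_truncation m (P j)"
    and mono: "\<And>j l f. j \<in> J \<Longrightarrow> l \<in> J \<Longrightarrow> j \<le> l \<Longrightarrow> truncation m (P j) f \<le> truncation m (P l) f"
    and lt: "\<And>j. j \<in> J \<Longrightarrow> truncation m (P j) q < m q"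
    and low: "\<And>f. degree f < degree q \<Longrightarrow> \<exists>j\<in>J. truncation m (P j) f = m f"
  shows "residual_truncation m q" "j \<in> J \<Longrightarrow> truncation m (P j) f \<le> truncation m q f"
proof -
  interpret poly_valuation m by (rule m)
  have u: "poly_valuation (truncation m (P j))" "truncation m (P j) f \<le> m f" if "j \<in> J" for j f
  proof -
    interpret R: residual_truncation m "P j" using that by (rule residual)
    show "poly_valuation (truncation m (P j))" by (rule R.trunc.poly_valuation_axioms)
    show "truncation m (P j) f \<le> m f" by (rule R.truncation_le)
  qed
  have "truncated_valuation m q"
  proof
    show "0 < degree q"
    proof (rule ccontr)
      assume "\<not> 0 < degree q"
      obtain j where j: "j \<in> J" using J by blast
      interpret R: residual_truncation m "P j" using j by (rule residual)
      have "truncation m (P j) q = m q"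
        using \<open>\<not> 0 < degree q\<close> R.degree_pos by (intro R.truncation_low_degree) simp
      then show False using lt[OF j] by simp
    qed
  qed
  then interpret T: truncated_valuation m q .
  have approx: "\<exists>j\<in>J. j0 \<le> j \<and> (\<forall>f\<in>S. truncation m (P j) f = m f)"
    if "finite S" "\<And>f. f \<in> S \<Longrightarrow> degree f < degree q" "j0 \<in> J" for S j0
    using that(1,2)
  proof (induction S rule: finite_induct)
    case empty
    then show ?case using that(3) by blast
  next
    case (insert f S)
    obtain j where j: "j \<in> J" "j0 \<le> j" "\<forall>f\<in>S. truncation m (P j) f = m f"
      using insert by blast
    obtain l where l: "l \<in> J" "truncation m (P l) f = m f" using insert.prems low by blast
    have stable: "truncation m (P k') g = m g"
      if "truncation m (P k) g = m g" "k \<le> k'" "k \<in> J" "k' \<in> J" for k k' g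
      using mono[OF that(3,4,2), of g] u(2)[OF that(4), of g] that(1) by simp
    have J': "max j l \<in> J" using j(1) l(1) by (simp add: max_def)
    have "truncation m (P (max j l)) f = m f"
      by (rule stable[OF l(2) _ l(1) J']) simp
    moreover have "truncation m (P (max j l)) g = m g" if "g \<in> S" for g
      by (rule stable[OF j(3)[rule_format, OF that] _ j(1) J']) simp
    moreover have "j0 \<le> max j l" using j(2) by (rule max.coboundedI1)
    ultimately show ?case using J' by blast
  qed
  obtain j0 where j0: "j0 \<in> J" using J by blast
  show "residual_truncation m q"
  proof
    fix a b :: "'a poly"
    assume ab: "a \<noteq> 0" "b \<noteq> 0" "degree a < degree q" "degree b < degree q"
    show "m (a * b) < m (a * b div q * q)"
      using ab
    proof (rule T.residual_of_approximations[rotated])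
      fix S :: "'a poly set"
      assume "finite S" "\<And>f. f \<in> S \<Longrightarrow> degree f < degree q"
      then obtain j where "j \<in> J" "\<forall>f\<in>S. truncation m (P j) f = m f"
        using approx j0 by meson
      then show "\<exists>u. poly_valuation u \<and> u q < m q \<and> (\<forall>f\<in>S. u f = m f)"
        using u lt by blast
    qed
  qed
  show "truncation m (P j) f \<le> truncation m q f" if "j \<in> J"
    using that
  proof (induction f arbitrary: j rule: T.division_induct)
    case (step s r)
    obtain l where l: "l \<in> J" "j \<le> l" "truncation m (P l) r = m r"
      using approx[of "{r}" j] step by auto
    let ?u = "truncation m (P l)"
    have le: "truncation m (P j) (s * q + r) \<le> ?u (s * q + r)"
      by (rule mono[OF step(3) l(1,2)])
    have bound: "?u (s * q + r) \<le> ?u s + ?u q" "?u (s * q + r) \<le> m r"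
      by (rule T.approximation_le_terms[OF u(1)[OF l(1)] u(2)[OF l(1)] lt[OF l(1)] l(3)])+
    have "?u s + ?u q \<le> truncation m q s + m q"
      using step(1)[OF l(1)] lt[OF l(1)] by (intro add_mono) auto
    then show ?case
      unfolding T.truncation_rec[OF step(2)]
      using le bound by (intro min.boundedI) (auto elim!: order_trans)
  qed simp
qed

text \<open>At a successor, minimality speaks of the truncation at the immediate predecessor only; it
  yields a smaller value of \<open>Q k\<close> under the truncations at all earlier indices because these
  increase with the index. This is why monotonicity is part of the induction.\<close>

lemma key_polynomials_residual:
  fixes m :: "'a::field poly \<Rightarrow> 'g::linordered_ab_group_add extended"
    and \<Lambda> :: "'i::wellorder set"
  assumes m: "poly_valuation m" and key: "key_polynomials m \<Lambda> Q" and "k \<in> \<Lambda>"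
  shows "residual_truncation m (Q k)"
proof -
  interpret poly_valuation m by (rule m)
  have "residual_truncation m (Q k) \<and>
    (\<forall>j\<in>\<Lambda>. j \<le> k \<longrightarrow> (\<forall>f. truncation m (Q j) f \<le> truncation m (Q k) f))"
    using \<open>k \<in> \<Lambda>\<close>
  proof (induction k rule: less_induct)
    case (less k)
    show ?case
    proof (cases "first_index \<Lambda> k")
      case True
      then have Qk: "Q k = [:0, 1:]" using key by (auto simp: key_polynomials_def)
      have "residual_truncation m (Q k)"
      proof
        fix a b :: "'a poly"
        assume ab: "a \<noteq> 0" "b \<noteq> 0" "degree a < degree (Q k)" "degree b < degree (Q k)"
        then have "a * b div Q k = 0"
          by (intro div_poly_less) (simp add: Qk degree_mult_eq)
        then show "m (a * b) < m (a * b div Q k * Q k)"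
          using ab by (cases "m (a * b)") auto
      qed (simp add: Qk)
      moreover have "j = k" if "j \<in> \<Lambda>" "j \<le> k" for j
        using True that by (auto simp: first_index_def intro: antisym)
      ultimately show ?thesis by blast
    next
      case False
      define J where "J = {j \<in> \<Lambda>. j < k}"
      have J: "J \<noteq> {}"
        using False less.prems by (force simp: first_index_def J_def not_le)
      have residual: "residual_truncation m (Q j)" if "j \<in> J" for j
        using less that by (auto simp: J_def)
      have mono: "truncation m (Q j) f \<le> truncation m (Q l) f"
        if "j \<in> J" "l \<in> J" "j \<le> l" for j l f
        using less.IH[of l] that by (auto simp: J_def)
      have le: "truncation m (Q j) f \<le> m f" if "j \<in> J" for j f
      proof -
        interpret R: residual_truncation m "Q j" using that by (rule residual)
        show ?thesis by (rule R.truncation_le)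
      qed
      have "(\<forall>j\<in>J. truncation m (Q j) (Q k) < m (Q k)) \<and>
        (\<forall>f. degree f < degree (Q k) \<longrightarrow> (\<exists>j\<in>J. truncation m (Q j) f = m f))"
      proof (cases "limit_index \<Lambda> k")
        case True
        then have "is_arg_min degree (\<lambda>f. \<forall>i\<in>\<Lambda>. i < k \<longrightarrow> truncation m (Q i) f < m f) (Q k)"
          using key by (auto simp: key_polynomials_def)
        then have lt: "\<And>j. j \<in> J \<Longrightarrow> truncation m (Q j) (Q k) < m (Q k)"
          and min: "\<And>f. degree f < degree (Q k) \<Longrightarrow> \<exists>j\<in>J. \<not> truncation m (Q j) f < m f"
          unfolding is_arg_min_def J_def by blast+
        have "\<exists>j\<in>J. truncation m (Q j) f = m f" if "degree f < degree (Q k)" for f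
          using min[OF that] le by (auto simp: order_le_less)
        then show ?thesis using lt by blast
      next
        case no_limit: False
        then obtain i where i: "next_index \<Lambda> i k"
          using False less.prems by (auto simp: limit_index_def)
        then have iJ: "i \<in> J" and top: "\<And>j. j \<in> J \<Longrightarrow> j \<le> i"
          by (fastforce simp: next_index_def J_def)+
        have *: "is_arg_min degree (\<lambda>f. truncation m (Q i) f < m f) (Q k)"
          using key i by (auto simp: key_polynomials_def)
        have "truncation m (Q j) (Q k) < m (Q k)" if "j \<in> J" for j
          using mono[OF that iJ top[OF that], of "Q k"] *
          by (auto simp: is_arg_min_def intro: order_le_less_trans)
        moreover have "truncation m (Q i) f = m f" if "degree f < degree (Q k)" for f
          using * that le[OF iJ, of f] by (auto simp: is_arg_min_def order_le_less)
        ultimately show ?thesis using iJ by blast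
      qed
      then have "\<And>j. j \<in> J \<Longrightarrow> truncation m (Q j) (Q k) < m (Q k)"
        and "\<And>f. degree f < degree (Q k) \<Longrightarrow> \<exists>j\<in>J. truncation m (Q j) f = m f"
        by blast+
      note step = key_polynomial_step[OF m J residual mono this]
      have "truncation m (Q j) f \<le> truncation m (Q k) f" if "j \<in> \<Lambda>" "j \<le> k" for j f
        using that step(2)[of j f] by (cases "j = k") (auto simp: J_def)
      then show ?thesis using step(1) by blast
    qed
  qed
  then show ?thesis by simp
qed

section \<open>Initial forms in the graded algebra\<close>

context poly_valuation
begin

lemma zero_in_filt_gt [simp]: "0 \<in> filt_gt m \<alpha>"
  by (simp add: filt_gt_def)

lemma filt_gt_add: "filt_gt m \<alpha> + filt_gt m \<alpha> = filt_gt m \<alpha>"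
proof
  show "filt_gt m \<alpha> + filt_gt m \<alpha> \<subseteq> filt_gt m \<alpha>"
    by (auto simp: filt_gt_def elim!: set_plus_elim intro: add_gt)
  show "filt_gt m \<alpha> \<subseteq> filt_gt m \<alpha> + filt_gt m \<alpha>"
    by (rule set_zero_plus2) simp
qed

lemma coset_filt_gt_eq:
  assumes "Fin \<alpha> < m (f - g)"
  shows "f +o filt_gt m \<alpha> = g +o filt_gt m \<alpha>"
proof -
  have "f +o filt_gt m \<alpha> \<subseteq> g +o filt_gt m \<alpha>" if "Fin \<alpha> < m (f - g)" for f g
  proof
    fix x assume "x \<in> f +o filt_gt m \<alpha>"
    then have "Fin \<alpha> < m (x - f)" by (auto simp: filt_gt_def elt_set_plus_def)
    then have "Fin \<alpha> < m ((x - f) + (f - g))" using that by (rule add_gt)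
    then show "x \<in> g +o filt_gt m \<alpha>"
      by (intro set_minus_imp_plus) (simp add: filt_gt_def)
  qed
  from this[of f g] this[of g f] assms show ?thesis by (simp add: diff_commute)
qed

text \<open>The zero polynomial counts as homogeneous of every degree, which avoids case distinctions for
  vanishing quotients and remainders.\<close>

lemma initial_form_eq:
  assumes "f = 0 \<or> m f = Fin \<alpha>"
  shows "initial_form m f = (\<lambda>\<beta>. if \<beta> = \<alpha> then f +o filt_gt m \<alpha> else filt_gt m \<beta>)"
  using assms by (auto simp: initial_form_def gr_def fun_eq_iff)

lemma gr_support_initial_form:
  assumes "m f = Fin \<alpha>"
  shows "gr_support m (initial_form m f) = {\<alpha>}"
proof -
  have "f + 0 \<in> f +o filt_gt m \<alpha>" by (rule set_plus_intro2) simp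
  moreover have "f \<notin> filt_gt m \<alpha>" using assms by (simp add: filt_gt_def)
  ultimately have "f +o filt_gt m \<alpha> \<noteq> filt_gt m \<alpha>" by auto
  then show ?thesis using assms by (auto simp: gr_support_def initial_form_eq[of f \<alpha>])
qed

lemma gr_support_initial_form_0: "gr_support m (initial_form m 0) = {}"
  by (simp add: gr_support_def initial_form_def gr_def)

text \<open>The set product of two cosets lies in the coset of \<open>f * g\<close>, but need not exhaust it: not every
  element of that coset factors. Adding the filtration step fills it up.\<close>

lemma coset_filt_gt_mult:
  assumes f: "m f = Fin \<alpha>" and g: "m g = Fin \<beta>"
  shows "(f +o filt_gt m \<alpha>) * (g +o filt_gt m \<beta>) + filt_gt m (\<alpha> + \<beta>) =
    f * g +o filt_gt m (\<alpha> + \<beta>)"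
proof
  show "f * g +o filt_gt m (\<alpha> + \<beta>) \<subseteq>
      (f +o filt_gt m \<alpha>) * (g +o filt_gt m \<beta>) + filt_gt m (\<alpha> + \<beta>)"
  proof (rule set_plus_mono3, rule set_times_intro)
    show "f \<in> f +o filt_gt m \<alpha>" using set_plus_intro2[of 0 "filt_gt m \<alpha>" f] by simp
    show "g \<in> g +o filt_gt m \<beta>" using set_plus_intro2[of 0 "filt_gt m \<beta>" g] by simp
  qed
  show "(f +o filt_gt m \<alpha>) * (g +o filt_gt m \<beta>) + filt_gt m (\<alpha> + \<beta>) \<subseteq>
      f * g +o filt_gt m (\<alpha> + \<beta>)"
  proof
    fix p assume "p \<in> (f +o filt_gt m \<alpha>) * (g +o filt_gt m \<beta>) + filt_gt m (\<alpha> + \<beta>)"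
    then obtain x y z where p: "p = (f + x) * (g + y) + z"
      and xyz: "Fin \<alpha> < m x" "Fin \<beta> < m y" "Fin (\<alpha> + \<beta>) < m z"
      by (auto simp: filt_gt_def elt_set_plus_def elim!: set_plus_elim set_times_elim)
    have "Fin \<beta> \<le> m (g + y)" using xyz g by (intro add_ge) auto
    have "Fin (\<alpha> + \<beta>) < m (x * (g + y))"
      using xyz(1) \<open>Fin \<beta> \<le> m (g + y)\<close> unfolding mult
      by (cases "m x"; cases "m (g + y)") (auto intro: add_less_le_mono)
    moreover have "Fin (\<alpha> + \<beta>) < m (f * y)"
      using xyz(2) f unfolding mult by (cases "m y") auto
    ultimately have "Fin (\<alpha> + \<beta>) < m (x * (g + y) + (f * y + z))"
      using xyz(3) by (intro add_gt)
    then show "p \<in> f * g +o filt_gt m (\<alpha> + \<beta>)"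
      by (intro set_minus_imp_plus) (simp add: p filt_gt_def algebra_simps)
  qed
qed

lemma initial_form_mult:
  "initial_form m f \<otimes>\<^bsub>gr m\<^esub> initial_form m g = initial_form m (f * g)"
proof (cases "f = 0 \<or> g = 0")
  case True
  then have "gr_support m (initial_form m f) = {} \<or> gr_support m (initial_form m g) = {}"
    by (auto simp: gr_support_initial_form_0)
  then have "initial_form m f \<otimes>\<^bsub>gr m\<^esub> initial_form m g = filt_gt m"
    by (auto simp: gr_def set_zero)
  then show ?thesis using True by (auto simp: initial_form_def gr_def)
next
  case False
  obtain \<alpha> \<beta> where \<alpha>: "m f = Fin \<alpha>" and \<beta>: "m g = Fin \<beta>"
    using False finite_value by metis
  have fg: "m (f * g) = Fin (\<alpha> + \<beta>)" by (simp add: mult \<alpha> \<beta>)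
  show ?thesis
  proof
    fix \<gamma>
    let ?I = "{(\<alpha>', \<beta>'). \<alpha>' \<in> {\<alpha>} \<and> \<beta>' \<in> {\<beta>} \<and> \<alpha>' + \<beta>' = \<gamma>}"
    have "(initial_form m f \<otimes>\<^bsub>gr m\<^esub> initial_form m g) \<gamma> =
        (\<Sum>(\<alpha>', \<beta>')\<in>?I. initial_form m f \<alpha>' * initial_form m g \<beta>') + filt_gt m \<gamma>"
      by (simp add: gr_def gr_support_initial_form[OF \<alpha>] gr_support_initial_form[OF \<beta>])
    also have "\<dots> = initial_form m (f * g) \<gamma>"
    proof (cases "\<gamma> = \<alpha> + \<beta>")
      case True
      then have "?I = {(\<alpha>, \<beta>)}" by auto
      then show ?thesis
        using True by (simp add: initial_form_eq[of f \<alpha>] initial_form_eq[of g \<beta>]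
            initial_form_eq[of "f * g" "\<alpha> + \<beta>"] \<alpha> \<beta> fg coset_filt_gt_mult)
    next
      case False
      then have I: "?I = {}" by auto
      show ?thesis
        unfolding I using False by (simp add: initial_form_eq[of "f * g" "\<alpha> + \<beta>"] fg set_zero)
    qed
    finally show "(initial_form m f \<otimes>\<^bsub>gr m\<^esub> initial_form m g) \<gamma> = initial_form m (f * g) \<gamma>" .
  qed
qed

lemma initial_form_add:
  assumes "m f = Fin \<alpha>" "g = 0 \<or> m g = Fin \<alpha>" "h = 0 \<or> m h = Fin \<alpha>"
    and "Fin \<alpha> < m (f - (g + h))"
  shows "initial_form m f = initial_form m g \<oplus>\<^bsub>gr m\<^esub> initial_form m h"
proof
  fix \<beta>
  show "initial_form m f \<beta> = (initial_form m g \<oplus>\<^bsub>gr m\<^esub> initial_form m h) \<beta>"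
    using coset_filt_gt_eq[OF assms(4)] assms(1)
    by (simp add: initial_form_eq[OF assms(2)] initial_form_eq[OF assms(3)] gr_def
        initial_form_eq[of f \<alpha>] set_plus_rearrange filt_gt_add)
qed

end

section \<open>Inverting initial forms of low degree\<close>

context residual_truncation
begin

text \<open>The euclidean algorithm for \<open>q\<close> and \<open>c\<close>, where each remainder is nonzero because the residue
  property excludes \<open>c k = q\<close>: the quotient of \<open>c k\<close> by \<open>q\<close> would be \<open>1\<close>.\<close>

lemma inverse_modulo_q:
  assumes "c \<noteq> 0" "degree c < degree q"
  shows "\<exists>c'. q dvd c * c' - 1"
  using assms
proof (induction "degree c" arbitrary: c rule: less_induct)
  case less
  show ?case
  proof (cases "degree c = 0")
    case True
    then obtain x where "c = [:x:]" by (rule degree_eq_zeroE)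
    then show ?thesis using less.prems
      by (intro exI[of _ "[:inverse x:]"]) (simp add: one_pCons)
  next
    case False
    define k r where "k = q div c" and "r = q mod c"
    have q: "q = k * c + r" by (simp add: k_def r_def)
    have "r \<noteq> 0"
    proof
      assume "r = 0"
      then have ck: "c * k = q" using q by simp
      then have "k \<noteq> 0" using q_nonzero by auto
      then have "degree k < degree q" using ck False less.prems by (auto simp: degree_mult_eq simp flip: ck)
      then have "m (c * k) < m (c * k div q * q)"
        using less.prems \<open>k \<noteq> 0\<close> by (intro residual)
      then show False by (simp add: ck)
    qed
    have "degree r < degree c"
      using degree_mod_less[of c q] less.prems \<open>r \<noteq> 0\<close> by (auto simp: r_def)
    then obtain r' where "q dvd r * r' - 1" using less \<open>r \<noteq> 0\<close> by (meson order_less_trans)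
    moreover have "c * (- k * r') - 1 = (r * r' - 1) - q * r'"
      by (simp add: q algebra_simps)
    ultimately have "q dvd c * (- k * r') - 1" by (metis dvd_diff dvd_triv_left)
    then show ?thesis by blast
  qed
qed

text \<open>Division of initial forms of low degree: \<open>a\<close> is the exact quotient of \<open>g\<close> by \<open>c\<close> modulo \<open>q\<close>,
  and the residue property turns the multiple of \<open>q\<close> in \<open>a c - g\<close> into an error of larger
  value.\<close>

lemma approximate_quotient:
  assumes c: "c \<noteq> 0" "degree c < degree q" and g: "g \<noteq> 0" "degree g < degree q"
  obtains a where "a \<noteq> 0" "degree a < degree q" "m a + m c = m g" "m g < w (a * c - g)"
proof -
  obtain c' where c': "q dvd c * c' - 1" using inverse_modulo_q[OF c] by blast
  define a where "a = c' * g mod q"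
  have a: "degree a < degree q"
    using degree_mod_less[of q "c' * g"] degree_pos by (auto simp: a_def)
  have "a * c - g = (c * c' - 1) * g - q * (c' * g div q * c)"
    unfolding a_def minus_mult_div_eq_mod[symmetric] by (simp add: algebra_simps)
  then have "q dvd a * c - g" using c' by (simp add: dvd_diff)
  then obtain s where s: "a * c - g = s * q" by (metis dvdE mult.commute)
  then have ac: "a * c = s * q + g" by (simp add: algebra_simps)
  have div: "a * c div q = s"
    using g by (simp add: ac div_poly_less poly_div_add_left)
  have "a \<noteq> 0"
  proof
    assume "a = 0"
    then have "q dvd g" using \<open>q dvd a * c - g\<close> by simp
    then show False using g dvd_imp_degree_le[of q g] by simp
  qed
  then have lt: "m (a * c) < m (s * q)" using residual[of a c] a c by (simp add: div)
  have eq: "m (a * c) = m g"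
  proof -
    have "m (a * c + - (s * q)) = min (m (a * c)) (m (- (s * q)))"
      using lt by (intro add_eq_min) simp
    moreover have "a * c + - (s * q) = g" by (simp add: ac)
    ultimately show ?thesis using lt by (simp add: min_absorb1)
  qed
  have "degree s < degree q" using degree_product_div[OF a c(2)] by (simp add: div)
  then have "w (a * c - g) = m (s * q)"
    by (simp add: s truncation_q_mult truncation_low_degree mult)
  then show thesis using that[of a] \<open>a \<noteq> 0\<close> a lt eq by (simp add: mult)
qed

section \<open>Division with remainder\<close>

text \<open>All exponents in the standard expansion of \<open>f\<close> are below \<open>d\<close>, expressed by the degree; the
  zero polynomial has degree \<open>0\<close> and needs the separate clause when \<open>d = 0\<close>.\<close>

definition expansion_below :: "nat \<Rightarrow> 'a poly \<Rightarrow> bool" where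
  "expansion_below d f \<longleftrightarrow> f = 0 \<or> degree f < d * degree q"

lemma expansion_below_0 [simp]: "expansion_below 0 f \<longleftrightarrow> f = 0"
  and expansion_below_zero [simp]: "expansion_below d 0"
  by (auto simp: expansion_below_def)

lemma expansion_below_diff:
  "expansion_below d f \<Longrightarrow> expansion_below d g \<Longrightarrow> expansion_below d (f - g)"
  unfolding expansion_below_def by (cases "f = 0"; cases "g = 0") (auto intro: degree_diff_less)

lemma expansion_below_mono: "expansion_below d f \<Longrightarrow> d \<le> e \<Longrightarrow> expansion_below e f"
  unfolding expansion_below_def by (meson mult_le_mono1 order_less_le_trans)

lemma expansion_below_Suc:
  assumes "degree r < degree q"
  shows "expansion_below (Suc d) (s * q + r) \<longleftrightarrow> expansion_below d s"
proof (cases "s = 0")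
  case True
  then show ?thesis using assms by (simp add: expansion_below_def)
next
  case False
  then have "degree (s * q) = degree s + degree q" by (simp add: degree_mult_eq)
  then have "degree (s * q + r) = degree s + degree q"
    using assms by (simp add: degree_add_eq_left)
  moreover from this have "s * q + r \<noteq> 0" using degree_pos by auto
  ultimately show ?thesis using False by (auto simp: expansion_below_def)
qed

lemma expansion_below_mult_power:
  "expansion_below d f \<Longrightarrow> expansion_below (d + k) (f * q ^ k)"
  unfolding expansion_below_def
  by (cases "f = 0") (auto simp: degree_mult_eq degree_power_eq add_mult_distrib)

lemma expansion_below_split:
  assumes "expansion_below (Suc d) f"
  obtains g f' where "f = g * q ^ d + f'" "degree g < degree q" "expansion_below d f'"
    "w f \<le> m g + m (q ^ d)" "w f \<le> w f'"
proof -
  have "\<exists>g f'. f = g * q ^ d + f' \<and> degree g < degree q \<and> expansion_below d f' \<and>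
    w f \<le> m g + m (q ^ d) \<and> w f \<le> w f'"
    using assms
  proof (induction d arbitrary: f)
    case 0
    then have "degree f < degree q" using degree_pos by (auto simp: expansion_below_def)
    then show ?case
      by (intro exI[of _ f] exI[of _ 0]) (auto simp: one truncation_low_degree)
  next
    case (Suc d)
    obtain s r where f: "f = s * q + r" "degree r < degree q" by (rule divide_by_q)
    have "expansion_below (Suc d) s"
      using Suc.prems by (simp add: f expansion_below_Suc)
    then obtain g s' where s: "s = g * q ^ d + s'" "degree g < degree q" "expansion_below d s'"
      "w s \<le> m g + m (q ^ d)" "w s \<le> w s'" using Suc.IH by blast
    have wf: "w f = min (w s + m q) (m r)" unfolding f(1) by (rule truncation_rec) fact
    show ?case
    proof (intro exI conjI)
      show "f = g * q ^ Suc d + (s' * q + r)" by (simp add: f(1) s(1) algebra_simps)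
      show "expansion_below (Suc d) (s' * q + r)" using s f by (simp add: expansion_below_Suc)
      have "w s + m q \<le> m g + m (q ^ d) + m q" using s by (intro add_right_mono)
      then have "w f \<le> m g + m (q ^ d) + m q" unfolding wf by (rule min.coboundedI1)
      then show "w f \<le> m g + m (q ^ Suc d)" by (simp add: mult ac_simps)
      have "w s + m q \<le> w s' + m q" using s by (intro add_right_mono)
      then show "w f \<le> w (s' * q + r)"
        unfolding wf truncation_rec[OF f(2)] by (simp add: min.coboundedI1)
    qed fact
  qed
  then show thesis using that by blast
qed

text \<open>Multiplying a coefficient by \<open>a\<close> may produce a carry into the next power of \<open>q\<close>, but by the
  residue property the carry has larger value and can be dropped.\<close>

lemma low_degree_mult_expansion_below:
  assumes a: "degree a < degree q"
  shows "expansion_below d f \<Longrightarrow> Fin \<alpha> \<le> m a + w f \<Longrightarrow>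
    \<exists>g. expansion_below d g \<and> Fin \<alpha> < w (a * f - g)"
proof (induction d arbitrary: f \<alpha>)
  case 0
  then show ?case by simp
next
  case (Suc d)
  obtain s r where f: "f = s * q + r" "degree r < degree q" by (rule divide_by_q)
  obtain b where b: "m q = Fin b" using finite_value q_nonzero by blast
  have "w f \<le> w s + m q" "w f \<le> m r" unfolding f(1) truncation_rec[OF f(2)] by simp_all
  then have le: "Fin \<alpha> \<le> m a + (w s + m q)" "Fin \<alpha> \<le> m a + m r"
    using Suc.prems(2) by (meson add_left_mono order_trans)+
  have "Fin (\<alpha> - b) \<le> m a + w s"
    using le(1) by (cases "m a"; cases "w s") (auto simp: b algebra_simps)
  then obtain g where g: "expansion_below d g" "Fin (\<alpha> - b) < w (a * s - g)"
    using Suc f by (auto simp: expansion_below_Suc)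
  obtain t u where tu: "a * r = t * q + u" "degree u < degree q"
    "Fin \<alpha> < w (t * q)"
  proof (cases "a * r = 0")
    case True
    then show thesis using that[of 0 0] degree_pos by simp
  next
    case False
    obtain t u where tu: "a * r = t * q + u" "degree u < degree q" "m (a * r) < w (t * q)"
      using product_residue[OF a f(2)] False by metis
    have "Fin \<alpha> \<le> m (a * r)" using le(2) by (simp only: mult)
    then show thesis using tu(3) by (intro that[OF tu(1,2)]) (rule order_le_less_trans)
  qed
  have "a * f - (g * q + u) = (a * s - g) * q + t * q"
    by (simp add: f(1) tu(1) algebra_simps)
  moreover have "Fin \<alpha> < w ((a * s - g) * q)"
    using g(2) unfolding truncation_q_mult by (cases "w (a * s - g)") (auto simp: b algebra_simps)
  ultimately have "Fin \<alpha> < w (a * f - (g * q + u))"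
    using tu(3) by (simp only: truncation_add_gt)
  then show ?case using g(1) tu(2) expansion_below_Suc by blast
qed

lemma term_value_eq: "term_value m q c j = w (coeff c j * q ^ j)"
  if "degree (coeff c j) < degree q"
  using that truncation_q_power_mult[of j "coeff c j"]
  by (simp add: term_value_def value_power truncation_low_degree mult.commute)

text \<open>At the highest index \<open>d\<close> where the minimum is attained the expansion splits into \<open>L\<close> below
  \<open>d\<close>, the term \<open>c q\<^sup>d\<close> and a tail \<open>B\<close> above \<open>d\<close>, invisible in the initial form.\<close>

lemma effective_degree_decomposition:
  assumes "h \<noteq> 0"
  obtains d c L B where "effective_degree m q h = Fin d"
    "c = coeff (std_expansion q h) d" "h = c * q ^ d + L + B"
    "c \<noteq> 0" "degree c < degree q" "m c + m (q ^ d) = w h"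
    "expansion_below d L" "w h < w B"
proof -
  define C where "C = std_expansion q h"
  define S where "S = {j. term_value m q C j = w h}"
  define T where "T j = coeff C j * q ^ j" for j
  have deg: "degree (coeff C j) < degree q" for j
    unfolding C_def by (rule std_expansion)
  have tv: "term_value m q C j = w (T j)" for j
    unfolding T_def by (rule term_value_eq) (rule deg)
  have wh: "w h = Min ((\<lambda>j. w (T j)) ` {..degree C})"
    unfolding tv[symmetric] by (simp add: truncation_def C_def Let_def)
  obtain \<eta> where \<eta>: "w h = Fin \<eta>" using trunc.finite_value assms by blast
  have "w h \<in> (\<lambda>j. w (T j)) ` {..degree C}" unfolding wh by (intro Min_in) auto
  then have "S \<noteq> {}" by (auto simp: S_def tv)
  have S_le: "j \<le> degree C" if "j \<in> S" for j
    using that by (intro le_degree) (auto simp: S_def tv \<eta> T_def)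
  then have "finite S" by (meson atMost_iff finite_atMost finite_subset subsetI)
  define d where "d = Max S"
  have d: "d \<in> S" unfolding d_def using \<open>finite S\<close> \<open>S \<noteq> {}\<close> by (rule Max_in)
  have above: "w h < w (T j)" if "d < j" "j \<le> degree C" for j
  proof -
    have "j \<notin> S" using that Max_ge[OF \<open>finite S\<close>, of j] by (auto simp: d_def)
    moreover have "w h \<le> w (T j)" unfolding wh using that by (intro Min_le) auto
    ultimately show ?thesis by (auto simp: S_def tv)
  qed
  show thesis
  proof
    show "effective_degree m q h = Fin d"
      using assms by (simp add: effective_degree_def d_def S_def C_def)
    show "coeff C d = coeff (std_expansion q h) d" by (simp add: C_def)
    have "h = poly C q" by (simp add: C_def std_expansion)
    also have "\<dots> = sum T {..degree C}" by (simp add: poly_altdef T_def)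
    also have "{..degree C} = insert d ({..<d} \<union> {d<..degree C})"
      using S_le[OF d] by auto
    also have "sum T \<dots> = T d + (sum T {..<d} + sum T {d<..degree C})"
      by (subst sum.insert, simp, simp, subst sum.union_disjoint) auto
    finally show "h = coeff C d * q ^ d + sum T {..<d} + sum T {d<..degree C}"
      by (simp add: T_def add.assoc)
    show "coeff C d \<noteq> 0" using d by (auto simp: S_def tv T_def \<eta>)
    show "degree (coeff C d) < degree q" by (rule deg)
    show "m (coeff C d) + m (q ^ d) = w h"
      using d by (simp add: S_def term_value_def value_power add.commute)
    show "expansion_below d (sum T {..<d})"
    proof (cases "d = 0")
      case False
      have "degree (sum T {..<d}) < d * degree q"
      proof (rule degree_sum_less)
        fix j assume "j \<in> {..<d}"
        then have "Suc j * degree q \<le> d * degree q" by (intro mult_le_mono1) auto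
        moreover have "degree (T j) \<le> degree (coeff C j) + j * degree q"
          unfolding T_def by (metis degree_mult_le degree_power_eq q_nonzero)
        ultimately show "degree (T j) < d * degree q" using deg[of j] by simp
      qed (use False degree_pos in auto)
      then show ?thesis by (simp add: expansion_below_def)
    qed simp
    show "w h < w (sum T {d<..degree C})"
      unfolding \<eta> using above by (intro trunc.sum_gt) (auto simp: \<eta>)
  qed
qed

lemma effective_degree_less:
  assumes "expansion_below d R" "R \<noteq> 0"
  shows "effective_degree m q R < Fin d"
proof -
  have "coeff (std_expansion q f) j = 0" if "expansion_below e f" "e \<le> j" for e f j
    using that
  proof (induction e arbitrary: f j)
    case (Suc e)
    obtain s r where f: "f = s * q + r" "degree r < degree q" by (rule divide_by_q)
    obtain j' where j: "j = Suc j'" using Suc.prems by (cases j) auto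
    show ?case using Suc by (simp add: f(1) std_expansion_rec[OF f(2)] j expansion_below_Suc[OF f(2)])
  qed simp
  moreover obtain d' where "effective_degree m q R = Fin d'" "coeff (std_expansion q R) d' \<noteq> 0"
    using effective_degree_decomposition[OF assms(2)] by metis
  ultimately show ?thesis using assms(1) by (force simp: not_le[symmetric])
qed

text \<open>Polynomial long division. The leading term \<open>g q\<^sup>e\<close> of the dividend \<open>A\<close> is cancelled by
  \<open>h a q\<^sup>k\<close>, where \<open>k = e - d\<close> and \<open>a\<close> approximates \<open>g / c\<close>. The cancellation is exact only
  modulo terms of value larger than \<open>\<alpha>\<close>; dropping these leaves a shorter expansion \<open>A1\<close>. In this
  way the remainder is a polynomial of genuinely small degree.\<close>

lemma initial_division:
  assumes h: "h = c * q ^ d + L + B" "c \<noteq> 0" "degree c < degree q"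
      "m c + m (q ^ d) = w h" "expansion_below d L" "w h < w B"
  shows "expansion_below e A \<Longrightarrow> Fin \<alpha> \<le> w A \<Longrightarrow>
    \<exists>X R. expansion_below d R \<and> Fin \<alpha> \<le> w (h * X) \<and> Fin \<alpha> < w (A - h * X - R)"
proof (induction e arbitrary: A)
  case 0
  then show ?case by (intro exI[of _ 0]) auto
next
  case (Suc e)
  have wL: "w h \<le> w L"
  proof -
    have "w (c * q ^ d) = w h"
      using truncation_q_power_mult[of d c] h
      by (simp add: truncation_low_degree mult.commute add.commute)
    then have "w h \<le> w (h - B - c * q ^ d)" using h(6) by (intro trunc.diff_ge) auto
    then show ?thesis by (subst (asm) (2) h(1)) simp
  qed
  show ?case
  proof (cases "Suc e \<le> d")
    case True
    then show ?thesis using expansion_below_mono[OF Suc.prems(1)] Suc.prems(2)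
      by (intro exI[of _ 0] exI[of _ A]) simp
  next
    case False
    define k where "k = e - d"
    have e: "e = d + k" using False by (simp add: k_def)
    obtain g A0 where A: "A = g * q ^ e + A0" "degree g < degree q" "expansion_below e A0"
      "w A \<le> m g + m (q ^ e)" "w A \<le> w A0"
      using expansion_below_split[OF Suc.prems(1)] .
    have g_ge: "Fin \<alpha> \<le> m g + m (q ^ e)" and A0_ge: "Fin \<alpha> \<le> w A0"
      using A Suc.prems by auto
    show ?thesis
    proof (cases "g = 0")
      case True
      then show ?thesis using A(1) Suc.IH[OF A(3) A0_ge] by simp
    next
      case False
      obtain a where a: "a \<noteq> 0" "degree a < degree q" "m a + m c = m g" "m g < w (a * c - g)"
        using approximate_quotient[OF h(2,3) False A(2)] .
      define X0 where "X0 = a * q ^ k"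
      have wX0: "w X0 = m a + m (q ^ k)"
        using truncation_q_power_mult[of k a] a
        by (simp add: X0_def truncation_low_degree mult.commute add.commute)
      have whX0: "w (h * X0) = m g + m (q ^ e)"
        by (simp add: trunc.mult wX0 e power_add mult ac_simps flip: h(4) a(3))
      have "h \<noteq> 0" using h(6) by auto
      then obtain \<tau> where \<tau>: "m a + w h = Fin \<tau>"
        using trunc.finite_value[of h] finite_value[OF a(1)] by (metis plus_extended.simps(1))
      have "Fin \<tau> \<le> m a + w L" unfolding \<tau>[symmetric] using wL by (rule add_left_mono)
      then obtain L' where L': "expansion_below d L'" "Fin \<tau> < w (a * L - L')"
        using low_degree_mult_expansion_below[OF a(2) h(5)] by blast
      have q_power: "w (f * q ^ j) = w f + m (q ^ j)" for f j
        using truncation_q_power_mult[of j f] by (simp add: mult.commute add.commute)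
      \<comment> \<open>\<open>L' q\<^sup>k\<close> stands in for \<open>a L q\<^sup>k\<close>, which need not be an expansion below \<open>e\<close>.\<close>
      define A1 where "A1 = A0 - L' * q ^ k"
      have "A - h * X0 - A1 = (a * L - L') * q ^ k * (- 1) + ((a * c - g) * q ^ e * (- 1) - B * X0)"
        by (simp add: A(1) A1_def h(1) X0_def e power_add algebra_simps)
      then have split: "A - h * X0 - A1 =
          - ((a * L - L') * q ^ k) + (- ((a * c - g) * q ^ e) - B * X0)" by simp
      have gt: "Fin \<alpha> < w (A - h * X0 - A1)"
        unfolding split
      proof (intro trunc.add_gt trunc.diff_gt, unfold trunc.minus)
        have "m (q ^ k) + Fin \<tau> < m (q ^ k) + w (a * L - L')"
          using L' by (intro extended_add_strict_left_mono) auto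
        moreover have "m (q ^ k) + Fin \<tau> = w (h * X0)"
          by (simp add: trunc.mult wX0 ac_simps flip: \<tau>)
        ultimately show "Fin \<alpha> < w ((a * L - L') * q ^ k)"
          using g_ge by (simp add: whX0 q_power add.commute)
        have "m (q ^ e) + m g < m (q ^ e) + w (a * c - g)"
          using a by (intro extended_add_strict_left_mono) auto
        then show "Fin \<alpha> < w ((a * c - g) * q ^ e)"
          using g_ge by (simp add: q_power add.commute)
        have "w X0 + w h < w X0 + w B"
          using h(6) a by (intro extended_add_strict_left_mono) (auto simp: X0_def)
        then show "Fin \<alpha> < w (B * X0)"
          using g_ge by (simp add: trunc.mult add.commute flip: whX0)
      qed
      have "Fin \<alpha> \<le> w A1"
        using trunc.remainder_ge[OF Suc.prems(2) _ gt] g_ge by (simp add: whX0)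
      moreover have "expansion_below e A1"
        using expansion_below_mult_power[OF L'(1), of k] A(3)
        by (simp add: A1_def e expansion_below_diff)
      ultimately obtain X1 R where X1: "expansion_below d R" "Fin \<alpha> \<le> w (h * X1)"
        "Fin \<alpha> < w (A1 - h * X1 - R)" using Suc.IH by blast
      show ?thesis
      proof (intro exI conjI)
        have "A - h * (X0 + X1) - R = (A - h * X0 - A1) + (A1 - h * X1 - R)"
          by (simp add: algebra_simps)
        then show "Fin \<alpha> < w (A - h * (X0 + X1) - R)" using gt X1(3) by (simp only: trunc.add_gt)
        show "Fin \<alpha> \<le> w (h * (X0 + X1))"
          unfolding distrib_left using g_ge X1(2) by (intro trunc.add_ge) (auto simp: whX0)
      qed fact
    qed
  qed
qed

text \<open>Division yields \<open>h X + R\<close> with the initial form of \<open>g\<close>, but \<open>h X\<close> or \<open>R\<close> may have value larger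
  than \<open>g\<close>, where their initial forms would live in a different degree. Such a summand does not
  affect the class of \<open>g\<close> and is replaced by \<open>0\<close>.\<close>

lemma graded_algebra_euclidean:
  assumes "h \<noteq> 0"
  shows "\<exists>X R. initial_form w g =
      initial_form w h \<otimes>\<^bsub>gr w\<^esub> initial_form w X \<oplus>\<^bsub>gr w\<^esub> initial_form w R \<and>
    (R = 0 \<or> 0 \<le> effective_degree m q R \<and> effective_degree m q R < effective_degree m q h)"
proof (cases "g = 0")
  case True
  have "initial_form w 0 = initial_form w 0 \<oplus>\<^bsub>gr w\<^esub> initial_form w 0"
    by (simp add: initial_form_def gr_def trunc.filt_gt_add)
  then show ?thesis
    using True trunc.initial_form_mult[of h 0] by (intro exI[of _ 0]) simp
next
  case False
  obtain \<alpha> where \<alpha>: "w g = Fin \<alpha>" using trunc.finite_value False by blast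
  obtain d c L B where d: "effective_degree m q h = Fin d" and h: "h = c * q ^ d + L + B"
    "c \<noteq> 0" "degree c < degree q" "m c + m (q ^ d) = w h" "expansion_below d L" "w h < w B"
    using effective_degree_decomposition[OF assms] by metis
  have "degree g < Suc (degree g) * degree q" using degree_pos by (cases "degree q") auto
  then have "expansion_below (Suc (degree g)) g" by (simp add: expansion_below_def)
  then obtain X R where XR: "expansion_below d R" "Fin \<alpha> \<le> w (h * X)"
    "Fin \<alpha> < w (g - h * X - R)"
    using initial_division[OF h, of "Suc (degree g)" g \<alpha>] \<alpha> by auto
  have R_ge: "Fin \<alpha> \<le> w R"
    using trunc.remainder_ge[OF _ XR(2,3)] \<alpha> by simp
  define X' where "X' = (if w (h * X) = Fin \<alpha> then X else 0)"
  define R' where "R' = (if w R = Fin \<alpha> then R else 0)"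
  have "Fin \<alpha> < w (h * X - h * X')" using XR(2) by (auto simp: X'_def)
  moreover have "Fin \<alpha> < w (R - R')" using R_ge by (auto simp: R'_def)
  ultimately have "Fin \<alpha> < w ((g - h * X - R) + ((h * X - h * X') + (R - R')))"
    using XR(3) by (intro trunc.add_gt)
  then have "Fin \<alpha> < w (g - (h * X' + R'))" by (simp add: algebra_simps)
  then have "initial_form w g = initial_form w (h * X') \<oplus>\<^bsub>gr w\<^esub> initial_form w R'"
    by (intro trunc.initial_form_add[OF \<alpha>]) (auto simp: X'_def R'_def)
  moreover have "0 \<le> effective_degree m q R' \<and> effective_degree m q R' < effective_degree m q h"
    if R': "R' \<noteq> 0"
  proof -
    have "expansion_below d R'" using XR(1) by (simp add: R'_def)
    moreover obtain d' where "effective_degree m q R' = Fin d'"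
      using effective_degree_decomposition[OF R'] by metis
    ultimately show ?thesis
      using effective_degree_less[of d R'] R' by (simp add: d zero_extended_def)
  qed
  ultimately show ?thesis by (metis trunc.initial_form_mult)
qed

end

theorem lemma3p15:
  fixes v :: "'a::field poly fract \<Rightarrow> 'g::linordered_ab_group_add extended"
    and \<Lambda> :: "'i::wellorder set"
    and Q :: "'i \<Rightarrow> 'a poly"
    and i :: 'i
    and g h :: "'a poly"
  assumes "valuation v"
    and "rank (value_set (on_const v)) = 1"
    and "on_poly v [:0, 1:] > 0"
    and "key_polynomials (on_poly v) \<Lambda> Q"
    and "one_complete v \<Lambda> Q"
    and "i \<in> \<Lambda>"
    and "h \<noteq> 0"
  shows "let \<mu>\<^sub>i = truncation (on_poly v) (Q i); \<delta>\<^sub>i = effective_degree (on_poly v) (Q i) in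
           \<exists>q r :: 'a poly.
             initial_form \<mu>\<^sub>i g =
               initial_form \<mu>\<^sub>i h \<otimes>\<^bsub>gr \<mu>\<^sub>i\<^esub> initial_form \<mu>\<^sub>i q \<oplus>\<^bsub>gr \<mu>\<^sub>i\<^esub> initial_form \<mu>\<^sub>i r \<and>
             (r = 0 \<or> 0 \<le> \<delta>\<^sub>i r \<and> \<delta>\<^sub>i r < \<delta>\<^sub>i h)"
proof -
  have "poly_valuation (on_poly v)"
    using assms(1) by unfold_locales (auto simp: valuation_def on_poly_def)
  then interpret residual_truncation "on_poly v" "Q i"
    using assms(4,6) by (rule key_polynomials_residual)
  show ?thesis
    unfolding Let_def by (rule graded_algebra_euclidean) (rule assms(7))
qed

end
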